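(* Let $p$ be prime, and let $M_p$ be the $p\times p$ matrix all of whose entries are $1$. Let $\theta$ be an aperiodic substitution on $\mathbb Z/(p\mathbb Z)$ with incidence matrix $M_p$, and let $\theta^*(j)=01\cdots(p-1)$ for each $j\in\mathbb Z/(p\mathbb Z)$. Suppose $\theta(0)$ starts with $0$. Let $(s(n))_{n\ge0}$ be the cocycle defined by $\theta$ and $\theta^*$, that is, the sequence of natural numbers with $\varphi_\theta^n(0^\infty)=\varphi_{\theta^*}^{s(n)}(0^\infty)$ for all $n\ge 0$. Then, for every $\alpha\ge0$, $(s(n)\bmod p^\alpha)_{n\ge0}$ is the fixed point of a length-$p$ substitution $\theta_\alpha$ (on the alphabet $\mathbb Z/(p^\alpha\mathbb Z)$).
   Context: A substitution on an alphabet $\mathcal A$ is a map $\theta:\mathcal A\to\mathcal A^*$, extended to $\mathcal A^{\mathbb N}$ by concatenation; it has length $p$ if every $\theta(a)$ has length $p$; a fixed point is $x\in\mathcal A^{\mathbb N}$ with $\theta(x)=x$. The incidence matrix of $\theta$ records how many times each letter occurs in each $\theta(j)$; incidence matrix $M_p$ on $\mathbb Z/(p\mathbb Z)=\{0,\dots,p-1\}$ means that each $\theta(j)$ is a word of length $p$ containing each letter exactly once. $\theta$ is aperiodic if it has a fixed point which is not periodic. Bratteli diagram $B$: an infinite directed graph with a root vertex joined by one edge to each of the $p$ vertices of level $0$, and with $p$ vertices labelled $0,\dots,p-1$ on each level $n=0,1,2,\dots$; for $n\ge1$ the number of edges from vertex $i$ on level $n-1$ to vertex $j$ on level $n$ is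 the $(i,j)$ entry of $M_p$, i.e. exactly one. $X_B$ is the set of infinite paths in $B$ starting at the root. A substitution $\theta$ with incidence matrix $M_p$ orders the incoming edges of each vertex at levels $n\ge1$: if the vertex is labelled $j$ and $\theta(j)=i_0i_1\cdots i_{p-1}$, the edge with source $i_k$ gets label $k$. A path is described by $x=x_0,x_1,\dots$, where $x_n$ is the label of its edge from level $n$ to level $n+1$. Two paths $x,x'$ are comparable iff they eventually agree, and if $n$ is the smallest integer such that they agree from level $n$ onwards then $x<x'$ iff $x_{n-1}<x'_{n-1}$. A path is maximal if all its edges have maximal label. The Vershik map $\varphi_\theta:X_B\to X_B$ sends each non-maximal path to its successor in this order: if $n$ is the smallest integer such that $x_n$ is not maximally labelled, the successor agrees with $x$ from level $n+1$ on, its edge between levels $n$ and $n+1$ is the successor of $x_n$ among the incoming edges of the same level-$(n+1)$ vertex, and it is minimal (all labels $0$) up to level $n$. On the finitely many maximal paths $\varphi_\theta$ is defined arbitrarily. The map $\varphi_{\theta^*}$ is defined in the same way, on the same $X_B$, using the order from $\theta^*$. $0^\infty$ denotes the path in $B$ that runs through the vertices labelled $0$ (it is minimal for both orders). *)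

theory Defs
  imports "HOL-Library.FuncSet" "HOL-Computational_Algebra.Primes"
begin

text \<open>
  The alphabet of integers modulo m is represented by its standard representatives, the set
  \<open>{..<m}\<close> of natural numbers.
\<close>

definition substitution :: "'a set \<Rightarrow> ('a \<Rightarrow> 'a list) \<Rightarrow> bool" where
  "substitution A \<theta> \<longleftrightarrow> (\<forall>a\<in>A. set (\<theta> a) \<subseteq> A)"

definition has_length :: "'a set \<Rightarrow> nat \<Rightarrow> ('a \<Rightarrow> 'a list) \<Rightarrow> bool" where
  "has_length A p \<theta> \<longleftrightarrow> (\<forall>a\<in>A. length (\<theta> a) = p)"

text \<open>
  \<open>subst_image \<theta> x y\<close> says that y is the infinite word \<open>\<theta> (x 0) \<theta> (x 1) \<theta> (x 2) \<dots>\<close>.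
  It is a relation because the concatenation may be finite when \<open>\<theta>\<close> erases letters;
  the second conjunct excludes that.
\<close>
definition subst_image :: "('a \<Rightarrow> 'a list) \<Rightarrow> (nat \<Rightarrow> 'a) \<Rightarrow> (nat \<Rightarrow> 'a) \<Rightarrow> bool" where
  "subst_image \<theta> x y \<longleftrightarrow>
     (\<forall>m. let w = concat (map (\<lambda>i. \<theta> (x i)) [0..<m]) in w = map y [0..<length w]) \<and>
     (\<forall>n. \<exists>m. n < length (concat (map (\<lambda>i. \<theta> (x i)) [0..<m])))"

definition fixed_point :: "'a set \<Rightarrow> ('a \<Rightarrow> 'a list) \<Rightarrow> (nat \<Rightarrow> 'a) \<Rightarrow> bool" where
  "fixed_point A \<theta> x \<longleftrightarrow> (\<forall>n. x n \<in> A) \<and> subst_image \<theta> x x"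

definition periodic_seq :: "(nat \<Rightarrow> 'a) \<Rightarrow> bool" where
  "periodic_seq x \<longleftrightarrow> (\<exists>k>0. \<forall>n. x (n + k) = x n)"

definition aperiodic :: "'a set \<Rightarrow> ('a \<Rightarrow> 'a list) \<Rightarrow> bool" where
  "aperiodic A \<theta> \<longleftrightarrow> (\<exists>x. fixed_point A \<theta> x \<and> \<not> periodic_seq x)"

definition incidence_matrix :: "('a \<Rightarrow> 'a list) \<Rightarrow> 'a \<Rightarrow> 'a \<Rightarrow> nat" where
  "incidence_matrix \<theta> i j = count_list (\<theta> j) i"

definition theta_star :: "nat \<Rightarrow> nat \<Rightarrow> nat list" where
  "theta_star p j = [0..<p]"

text \<open>\<open>Vertex n i\<close> is the vertex labelled i on level n.\<close>
datatype vertex = Root | Vertex nat nat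

text \<open>
  The Bratteli diagram B of the \<open>p \<times> p\<close> matrix with all entries 1. It has no multiple edges,
  so an edge is the pair of its source and its target.
\<close>
definition edges :: "nat \<Rightarrow> (vertex \<times> vertex) set" where
  "edges p = {(Root, Vertex 0 i) | i. i < p} \<union>
             {(Vertex n i, Vertex (Suc n) j) | n i j. i < p \<and> j < p}"

text \<open>
  A path is the sequence of its vertices. The root comes first, so \<open>x (Suc n)\<close> is the vertex
  on level n.
\<close>
definition paths :: "nat \<Rightarrow> (nat \<Rightarrow> vertex) set" where
  "paths p = {x. x 0 = Root \<and> (\<forall>n. (x n, x (Suc n)) \<in> edges p)}"

fun edge_label :: "(nat \<Rightarrow> nat list) \<Rightarrow> vertex \<times> vertex \<Rightarrow> nat" where
  "edge_label \<theta> (Vertex n i, Vertex m j) = (THE k. k < length (\<theta> j) \<and> \<theta> j ! k = i)"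

text \<open>The label of the edge of x from level n to level \<open>n + 1\<close> in the order given by \<open>\<theta>\<close>.\<close>
definition path_label :: "(nat \<Rightarrow> nat list) \<Rightarrow> (nat \<Rightarrow> vertex) \<Rightarrow> nat \<Rightarrow> nat" where
  "path_label \<theta> x n = edge_label \<theta> (x (Suc n), x (Suc (Suc n)))"

definition maximal_path :: "nat \<Rightarrow> (nat \<Rightarrow> nat list) \<Rightarrow> (nat \<Rightarrow> vertex) \<Rightarrow> bool" where
  "maximal_path p \<theta> x \<longleftrightarrow> (\<forall>n. path_label \<theta> x n = p - 1)"

text \<open>
  y is the successor of the non-maximal path x: n is the first position at which x is not
  maximally labelled, and y agrees with x from level \<open>n + 1\<close> on.
\<close>
definition path_successor ::
  "nat \<Rightarrow> (nat \<Rightarrow> nat list) \<Rightarrow> (nat \<Rightarrow> vertex) \<Rightarrow> (nat \<Rightarrow> vertex) \<Rightarrow> bool" where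
  "path_successor p \<theta> x y \<longleftrightarrow>
     (\<exists>n. path_label \<theta> x n \<noteq> p - 1 \<and> (\<forall>k<n. path_label \<theta> x k = p - 1) \<and>
          (\<forall>m\<ge>Suc n. y (Suc m) = x (Suc m)) \<and>
          path_label \<theta> y n = Suc (path_label \<theta> x n) \<and>
          (\<forall>k<n. path_label \<theta> y k = 0))"

text \<open>Any values in \<open>paths p\<close> are allowed on the maximal paths.\<close>
definition vershik_map ::
  "nat \<Rightarrow> (nat \<Rightarrow> nat list) \<Rightarrow> ((nat \<Rightarrow> vertex) \<Rightarrow> (nat \<Rightarrow> vertex)) \<Rightarrow> bool" where
  "vershik_map p \<theta> \<phi> \<longleftrightarrow> \<phi> \<in> paths p \<rightarrow> paths p \<and>
     (\<forall>x\<in>paths p. \<not> maximal_path p \<theta> x \<longrightarrow> path_successor p \<theta> x (\<phi> x))"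

definition zero_path :: "nat \<Rightarrow> vertex" where
  "zero_path n = (case n of 0 \<Rightarrow> Root | Suc m \<Rightarrow> Vertex m 0)"

text \<open>The sequence is unique when x has an infinite \<open>\<psi>\<close>-orbit.\<close>
definition cocycle :: "('x \<Rightarrow> 'x) \<Rightarrow> ('x \<Rightarrow> 'x) \<Rightarrow> 'x \<Rightarrow> nat \<Rightarrow> nat" where
  "cocycle \<phi> \<psi> x = (THE s. \<forall>n. (\<phi> ^^ n) x = (\<psi> ^^ s n) x)"

end

theory Submission
  imports Defs
begin

text \<open>
  Let \<open>u\<close> be the fixed point of \<open>\<theta>\<close> starting with 0. After \<open>n\<close> steps of the Vershik map the labels
  of the path are the base \<open>p\<close> digits of \<open>n\<close>, so its vertex on level \<open>k\<close> is \<open>u (n div p ^ k)\<close>. For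
  \<open>\<theta>\<^sup>*\<close> the vertices themselves are the base \<open>p\<close> digits of \<open>n\<close>. Hence \<open>s n\<close> is the
  number with digits \<open>u (n div p ^ k)\<close>, i.e. \<open>s (p * n + j) = \<theta> (u n) ! j + p * s n\<close> with
  \<open>u n = s n mod p\<close>, and the right-hand side modulo \<open>p ^ \<alpha>\<close> depends on \<open>s n\<close> modulo \<open>p ^ \<alpha>\<close> only.
\<close>

section \<open>Base \<open>p\<close> recursions and digits\<close>

function fixed_word :: "nat \<Rightarrow> (nat \<Rightarrow> nat list) \<Rightarrow> nat \<Rightarrow> nat" where
  "fixed_word p \<theta> n =
     (if n = 0 \<or> p < 2 then 0 else \<theta> (fixed_word p \<theta> (n div p)) ! (n mod p))"
  by pat_completeness auto
termination by (relation "measure (\<lambda>(p, \<theta>, n). n)") auto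

text \<open>For \<open>p \<ge> 2\<close> this is the sum of \<open>p ^ k * u (n div p ^ k)\<close>
  over all \<open>k\<close> with \<open>n div p ^ k \<noteq> 0\<close>. When \<open>u 0 = 0\<close>,
  the sum may as well run over all \<open>k\<close>.\<close>

function radix_value :: "nat \<Rightarrow> (nat \<Rightarrow> nat) \<Rightarrow> nat \<Rightarrow> nat" where
  "radix_value p u n = (if n = 0 \<or> p < 2 then 0 else u n + p * radix_value p u (n div p))"
  by pat_completeness auto
termination by (relation "measure (\<lambda>(p, u, n). n)") auto

declare fixed_word.simps [simp del] radix_value.simps [simp del]

lemma radix_value_rec:
  assumes "p \<ge> 2" "u 0 = 0"
  shows "radix_value p u n = u n + p * radix_value p u (n div p)"
  using assms by (cases "n = 0") (auto simp: radix_value.simps[of p u n] radix_value.simps[of p u 0])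

text \<open>As \<open>u n < p\<close>, division by \<open>p\<close> removes exactly the last digit
  \<open>u n\<close>, and this can be iterated.\<close>

lemma radix_value_div_power:
  assumes "p \<ge> 2" "u 0 = 0" "\<And>n. u n < p"
  shows "radix_value p u n div p ^ k = radix_value p u (n div p ^ k)"
proof (induction k)
  case (Suc k)
  have "radix_value p u m div p = radix_value p u (m div p)" for m
    using assms by (subst radix_value_rec) auto
  then show ?case
    using Suc by (metis div_mult2_eq power_Suc2)
qed simp

lemma radix_value_mod:
  assumes "p \<ge> 2" "u 0 = 0" "\<And>n. u n < p"
  shows "radix_value p u n mod p = u n"
  using assms by (subst radix_value_rec) auto

lemma digits_eq_imp_eq:
  fixes m n p :: nat
  assumes "p \<ge> 2" "\<And>k. m div p ^ k mod p = n div p ^ k mod p"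
  shows "m = n"
  using assms(2)
proof (induction m arbitrary: n rule: less_induct)
  case (less m)
  have mod: "m mod p = n mod p"
    using less.prems[of 0] by simp
  have digits: "m div p div p ^ k mod p = n div p div p ^ k mod p" for k
    using less.prems[of "Suc k"] by (simp add: div_mult2_eq)
  show ?case
  proof (cases "m = 0")
    case True
    have "n = 0"
    proof (rule ccontr)
      assume "n \<noteq> 0"
      \<comment> \<open>For \<open>m = 0\<close> the quotient \<open>m div p\<close> is not smaller
        than \<open>m\<close>, so the outer induction hypothesis is of no use; instead a nonzero
        digit of \<open>n\<close> is found by induction on \<open>n\<close>.\<close>
      have "\<exists>k. n div p ^ k mod p \<noteq> 0"
        using \<open>n \<noteq> 0\<close>
      proof (induction n rule: less_induct)
        case (less n)
        show ?case
        proof (cases "n mod p = 0")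
          case True
          with less.prems assms(1) have "n div p \<noteq> 0" "n div p < n"
            by auto
          with less.IH obtain k where "n div p div p ^ k mod p \<noteq> 0"
            by blast
          then show ?thesis
            by (intro exI[of _ "Suc k"]) (simp add: div_mult2_eq)
        qed (auto intro: exI[of _ 0])
      qed
      with less.prems True show False
        by simp
    qed
    with True show ?thesis
      by simp
  next
    case False
    then have "m div p = n div p"
      using assms(1) less.IH digits by simp
    with mod show ?thesis
      by (metis div_mult_mod_eq)
  qed
qed

text \<open>The carry rule: adding 1 turns \<open>N\<close> trailing digits \<open>p - 1\<close>
  into zeros and passes the 1 on to \<open>n div p ^ N\<close>.\<close>

lemma Suc_eq_of_maximal_digits:
  fixes n p :: nat
  assumes "p \<ge> 1" "\<And>k. k < N \<Longrightarrow> n div p ^ k mod p = p - 1"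
  shows "Suc n = p ^ N * Suc (n div p ^ N)"
  using assms(2)
proof (induction N)
  case (Suc N)
  have "n div p ^ N = p * (n div p ^ Suc N) + (p - 1)"
    using Suc.prems[of N] mult_div_mod_eq[of p "n div p ^ N"]
    by (simp add: div_mult2_eq power_Suc2 del: power_Suc)
  then have "Suc (n div p ^ N) = p * Suc (n div p ^ Suc N)"
    using assms(1) by simp
  then show ?case
    using Suc by (simp add: algebra_simps)
qed simp

text \<open>The images of the first \<open>m\<close> letters fill exactly the positions below
  \<open>m * p\<close>, so comparing block by block suffices.\<close>

lemma subst_image_if_constant_length:
  assumes "p \<ge> 1" "\<And>i. length (\<theta> (x i)) = p" "\<And>i j. j < p \<Longrightarrow> y (i * p + j) = \<theta> (x i) ! j"
  shows "subst_image \<theta> x y"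
proof -
  have block: "\<theta> (x i) = map y [i * p..<i * p + p]" for i
    using assms by (intro nth_equalityI) auto
  have image: "concat (map (\<lambda>i. \<theta> (x i)) [0..<m]) = map y [0..<m * p]" for m
  proof (induction m)
    case (Suc m)
    have "[0..<Suc m * p] = [0..<m * p] @ [m * p..<m * p + p]"
      by (metis add.commute mult_Suc upt_add_eq_append zero_le)
    then show ?case
      using Suc block by simp
  qed simp
  have "\<exists>m. n < m * p" for n
    using assms(1) by (intro exI[of _ "Suc n"]) (metis Suc_le_eq mult.right_neutral mult_le_mono2)
  then show ?thesis
    unfolding subst_image_def image by (simp add: Let_def)
qed

section \<open>The Vershik orbit of the zero path\<close>

definition orbit_path :: "nat \<Rightarrow> (nat \<Rightarrow> nat list) \<Rightarrow> nat \<Rightarrow> nat \<Rightarrow> vertex" where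
  "orbit_path p \<theta> n l =
     (case l of 0 \<Rightarrow> Root | Suc k \<Rightarrow> Vertex k (fixed_word p \<theta> (n div p ^ k)))"

lemma path_vertex:
  assumes "x \<in> paths p"
  obtains i where "i < p" "x (Suc n) = Vertex n i"
proof -
  have edge: "(x n, x (Suc n)) \<in> edges p" for n
    using assms by (simp add: paths_def)
  have "\<exists>i<p. x (Suc n) = Vertex n i"
  proof (induction n)
    case 0
    have "x 0 = Root"
      using assms by (simp add: paths_def)
    with edge[of 0] show ?case
      by (auto simp: edges_def)
  next
    case (Suc n)
    with edge[of "Suc n"] show ?case
      by (auto simp: edges_def)
  qed
  then show thesis
    using that by blast
qed

text \<open>Every word is a permutation of the alphabet, as the all-ones incidence matrix demands.
  The locale serves both \<open>\<theta>\<close> and \<open>theta_star p\<close>.\<close>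

locale permutation_order =
  fixes p :: nat and \<theta> :: "nat \<Rightarrow> nat list"
  assumes p_ge_2: "p \<ge> 2"
    and distinct_word: "j < p \<Longrightarrow> distinct (\<theta> j)"
    and set_word: "j < p \<Longrightarrow> set (\<theta> j) = {..<p}"
    and first_letter: "\<theta> 0 ! 0 = 0"
begin

lemma length_word: "j < p \<Longrightarrow> length (\<theta> j) = p"
  by (metis card_lessThan distinct_card distinct_word set_word)

lemma nth_word_less: "j < p \<Longrightarrow> k < p \<Longrightarrow> \<theta> j ! k < p"
  by (metis length_word lessThan_iff nth_mem set_word)

lemma fixed_word_0: "fixed_word p \<theta> 0 = 0"
  by (simp add: fixed_word.simps)

text \<open>At \<open>n = 0\<close> the recursion holds because \<open>\<theta> 0\<close> starts
  with 0.\<close>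

lemma fixed_word_rec: "fixed_word p \<theta> n = \<theta> (fixed_word p \<theta> (n div p)) ! (n mod p)"
  using p_ge_2 first_letter
  by (cases "n = 0") (simp_all add: fixed_word_0 fixed_word.simps[of p \<theta> n])

lemma fixed_word_less: "fixed_word p \<theta> n < p"
proof (induction n rule: less_induct)
  case (less n)
  show ?case
  proof (cases "n = 0")
    case False
    then have "fixed_word p \<theta> (n div p) < p"
      using less p_ge_2 by simp
    then show ?thesis
      using p_ge_2 by (subst fixed_word_rec) (simp add: nth_word_less)
  qed (use p_ge_2 in \<open>simp add: fixed_word_0\<close>)
qed

text \<open>Each letter occurs exactly once in \<open>\<theta> j\<close>, so the description in
  \<open>edge_label\<close> has a unique witness.\<close>

lemma edge_label_eq_iff:
  assumes "i < p" "j < p"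
  shows "edge_label \<theta> (Vertex n i, Vertex m j) = k \<longleftrightarrow> k < p \<and> \<theta> j ! k = i"
proof -
  obtain k' where k': "k' < p" "\<theta> j ! k' = i"
    using assms set_word[of j] length_word[of j] by (metis in_set_conv_nth lessThan_iff)
  have unique: "l = k'" if "l < p" "\<theta> j ! l = i" for l
    using that k' assms distinct_word[of j] length_word[of j] by (metis nth_eq_iff_index_eq)
  have "edge_label \<theta> (Vertex n i, Vertex m j) = k'"
    unfolding edge_label.simps length_word[OF assms(2)] using unique k' by blast
  then show ?thesis
    using unique k' by metis
qed

lemma orbit_path_in_paths: "orbit_path p \<theta> n \<in> paths p"
  using fixed_word_less by (auto simp: paths_def orbit_path_def edges_def split: nat.split)

text \<open>This is \<open>fixed_word_rec\<close> at \<open>n div p ^ k\<close>: the vertex on level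
  \<open>k\<close> is the letter at position \<open>n div p ^ k mod p\<close> in the word of the
  vertex on level \<open>k + 1\<close>.\<close>

lemma path_label_orbit_path: "path_label \<theta> (orbit_path p \<theta> n) k = n div p ^ k mod p"
proof -
  have "edge_label \<theta> (Vertex k (fixed_word p \<theta> (n div p ^ k)),
      Vertex (Suc k) (fixed_word p \<theta> (n div p ^ k div p))) = n div p ^ k mod p"
    unfolding edge_label_eq_iff[OF fixed_word_less fixed_word_less]
    using p_ge_2 fixed_word_rec[of "n div p ^ k"] by simp
  moreover have "n div (p * p ^ k) = n div p ^ k div p"
    by (metis div_mult2_eq mult.commute)
  ultimately show ?thesis
    by (simp add: path_label_def orbit_path_def del: edge_label.simps)
qed

text \<open>The target and the label of an edge determine its source, so agreement from level
  \<open>N\<close> on propagates down to level 0.\<close>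

lemma path_eqI:
  assumes "x \<in> paths p" "y \<in> paths p"
    and tail: "\<And>m. m \<ge> N \<Longrightarrow> x (Suc m) = y (Suc m)"
    and labels: "\<And>k. k < N \<Longrightarrow> path_label \<theta> x k = path_label \<theta> y k"
  shows "x = y"
proof -
  have "x (Suc m) = y (Suc m)" if "m \<le> N" for m
    using that
  proof (induction m rule: inc_induct)
    case base
    show ?case
      by (simp add: tail)
  next
    case (step m)
    obtain i where i: "i < p" "x (Suc m) = Vertex m i"
      using path_vertex[OF assms(1)] by blast
    obtain i' where i': "i' < p" "y (Suc m) = Vertex m i'"
      using path_vertex[OF assms(2)] by blast
    obtain j where j: "j < p" "x (Suc (Suc m)) = Vertex (Suc m) j"
      using path_vertex[OF assms(1)] by blast
    have "edge_label \<theta> (Vertex m i, Vertex (Suc m) j) = edge_label \<theta> (Vertex m i', Vertex (Suc m) j)"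
      using labels[of m] step i i' j by (simp add: path_label_def del: edge_label.simps)
    then have "i = i'"
      using edge_label_eq_iff i(1) i'(1) j(1) by metis
    with i i' show ?case
      by simp
  qed
  with tail have "x (Suc m) = y (Suc m)" for m
    by (cases "m \<le> N") auto
  moreover have "x 0 = y 0"
    using assms by (simp add: paths_def)
  ultimately show ?thesis
    by (metis ext not0_implies_Suc)
qed

text \<open>Taking the successor acts on labels as adding 1 acts on base \<open>p\<close> digits:
  the first digit other than \<open>p - 1\<close> goes up by one, the digits before it become 0, and
  the later ones stay.\<close>

lemma path_successor_orbit_path:
  assumes "path_successor p \<theta> (orbit_path p \<theta> n) y" "y \<in> paths p"
  shows "y = orbit_path p \<theta> (Suc n)"
proof -
  obtain N where N: "n div p ^ N mod p \<noteq> p - 1" "\<And>k. k < N \<Longrightarrow> n div p ^ k mod p = p - 1"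
    and tail: "\<And>m. m \<ge> Suc N \<Longrightarrow> y (Suc m) = orbit_path p \<theta> n (Suc m)"
    and label: "path_label \<theta> y N = Suc (n div p ^ N mod p)"
    and zeros: "\<And>k. k < N \<Longrightarrow> path_label \<theta> y k = 0"
    using assms(1) unfolding path_successor_def path_label_orbit_path by blast
  have carry: "Suc n = p ^ k * Suc (n div p ^ k)" if "k \<le> N" for k
    using that N(2) p_ge_2 by (intro Suc_eq_of_maximal_digits) auto
  have "Suc n div p ^ N = Suc (n div p ^ N)"
    using carry[OF order_refl] p_ge_2
    by (metis nonzero_mult_div_cancel_left not_numeral_le_zero power_not_zero)
  \<comment> \<open>Digit \<open>N\<close> is not \<open>p - 1\<close>, so the carry stops
    there.\<close>
  moreover have "Suc (n div p ^ N) mod p = Suc (n div p ^ N mod p)"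
    and "Suc (n div p ^ N) div p = n div p ^ N div p"
    using N(1) by (auto simp: mod_Suc div_Suc)
  ultimately have digit: "Suc n div p ^ N mod p = Suc (n div p ^ N mod p)"
    and div_Suc_N: "Suc n div p ^ Suc N = n div p ^ Suc N"
    by (simp_all add: div_mult2_eq power_Suc2 del: power_Suc)
  show ?thesis
  proof (rule path_eqI[OF assms(2) orbit_path_in_paths, of "Suc N"])
    fix m assume m: "m \<ge> Suc N"
    then have "Suc n div p ^ m = n div p ^ m"
      using div_Suc_N by (metis div_mult2_eq le_Suc_ex power_add)
    with tail m show "y (Suc m) = orbit_path p \<theta> (Suc n) (Suc m)"
      by (simp add: orbit_path_def)
  next
    fix k assume "k < Suc N"
    then consider "k = N" | "k < N"
      by linarith
    then show "path_label \<theta> y k = path_label \<theta> (orbit_path p \<theta> (Suc n)) k"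
    proof cases
      case 1
      with label digit show ?thesis
        by (simp only: path_label_orbit_path)
    next
      case 2
      \<comment> \<open>The carry rule at \<open>Suc k \<le> N\<close> makes \<open>Suc n\<close>
        divisible by \<open>p ^ Suc k\<close>, so its digit \<open>k\<close> is 0.\<close>
      then have "Suc n = p ^ k * (p * Suc (n div p ^ Suc k))"
        using carry[of "Suc k"] by (simp add: algebra_simps)
      then have "Suc n div p ^ k = p * Suc (n div p ^ Suc k)"
        using p_ge_2 by (metis nonzero_mult_div_cancel_left not_numeral_le_zero power_not_zero)
      then have "Suc n div p ^ k mod p = 0"
        by simp
      with zeros 2 show ?thesis
        by (simp only: path_label_orbit_path)
    qed
  qed
qed

text \<open>Since \<open>n < p ^ n\<close>, the digit of \<open>n\<close> at position
  \<open>n\<close> is 0, which differs from \<open>p - 1\<close>. Hence the arbitrary values on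
  maximal paths never enter the orbit.\<close>

lemma not_maximal_orbit_path: "\<not> maximal_path p \<theta> (orbit_path p \<theta> n)"
proof
  assume "maximal_path p \<theta> (orbit_path p \<theta> n)"
  then have "n div p ^ n mod p = p - 1"
    by (simp add: maximal_path_def path_label_orbit_path)
  moreover have "n < p ^ n"
    using p_ge_2 by (simp add: power_gt_expt)
  ultimately show False
    using p_ge_2 by simp
qed

lemma vershik_map_orbit:
  assumes "vershik_map p \<theta> \<phi>"
  shows "(\<phi> ^^ n) zero_path = orbit_path p \<theta> n"
proof (induction n)
  case 0
  show ?case
    by (rule ext) (simp add: zero_path_def orbit_path_def fixed_word_0 split: nat.split)
next
  case (Suc n)
  have "\<phi> (orbit_path p \<theta> n) \<in> paths p"
    "path_successor p \<theta> (orbit_path p \<theta> n) (\<phi> (orbit_path p \<theta> n))"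
    using assms orbit_path_in_paths not_maximal_orbit_path by (auto simp: vershik_map_def)
  then show ?case
    using Suc path_successor_orbit_path by simp
qed

end

section \<open>Comparison with the standard order\<close>

lemma permutation_order_theta_star: "p \<ge> 2 \<Longrightarrow> permutation_order p (theta_star p)"
  by unfold_locales (auto simp: theta_star_def)

text \<open>\<open>theta_star p\<close> ignores its argument, so one step of the recursion already
  gives the value.\<close>

lemma fixed_word_theta_star: "p \<ge> 2 \<Longrightarrow> fixed_word p (theta_star p) n = n mod p"
  by (subst permutation_order.fixed_word_rec[OF permutation_order_theta_star])
    (simp_all add: theta_star_def)

lemma (in permutation_order) cocycle_eq_radix_value:
  assumes "vershik_map p \<theta> \<phi>" "vershik_map p (theta_star p) \<psi>"
  shows "cocycle \<phi> \<psi> zero_path = radix_value p (fixed_word p \<theta>)"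
proof -
  interpret star: permutation_order p "theta_star p"
    by (rule permutation_order_theta_star[OF p_ge_2])
  \<comment> \<open>As an equivalence in \<open>m\<close>, this yields both existence and uniqueness
    for the description in \<open>cocycle\<close>.\<close>
  have "(\<phi> ^^ n) zero_path = (\<psi> ^^ m) zero_path \<longleftrightarrow> m = radix_value p (fixed_word p \<theta>) n"
    (is "?L \<longleftrightarrow> m = ?r") for n m
  proof -
    have "?L \<longleftrightarrow> (\<forall>k. fixed_word p \<theta> (n div p ^ k) = m div p ^ k mod p)"
      unfolding vershik_map_orbit[OF assms(1)] star.vershik_map_orbit[OF assms(2)] fun_eq_iff
      by (auto simp: orbit_path_def fixed_word_theta_star p_ge_2 split: nat.split)
    also have "\<dots> \<longleftrightarrow> (\<forall>k. m div p ^ k mod p = ?r div p ^ k mod p)"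
      using p_ge_2 fixed_word_0 fixed_word_less
      by (auto simp: radix_value_div_power radix_value_mod)
    also have "\<dots> \<longleftrightarrow> m = ?r"
      using digits_eq_imp_eq p_ge_2 by blast
    finally show ?thesis .
  qed
  then show ?thesis
    unfolding cocycle_def by (intro the_equality) auto
qed

section \<open>Reduction modulo powers of \<open>p\<close>\<close>

theorem theorem4p12:
  fixes p :: nat and \<theta> :: "nat \<Rightarrow> nat list"
    and \<phi>\<^sub>\<theta> \<phi>\<^sub>s\<^sub>t\<^sub>a\<^sub>r :: "(nat \<Rightarrow> vertex) \<Rightarrow> (nat \<Rightarrow> vertex)"
    and s :: "nat \<Rightarrow> nat"
  assumes "prime p"
    and "substitution {..<p} \<theta>"
    and "\<forall>i<p. \<forall>j<p. incidence_matrix \<theta> i j = 1"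
    and "aperiodic {..<p} \<theta>"
    and "\<theta> 0 ! 0 = 0"
    and "vershik_map p \<theta> \<phi>\<^sub>\<theta>"
    and "vershik_map p (theta_star p) \<phi>\<^sub>s\<^sub>t\<^sub>a\<^sub>r"
    and "s = cocycle \<phi>\<^sub>\<theta> \<phi>\<^sub>s\<^sub>t\<^sub>a\<^sub>r zero_path"
  shows "\<forall>\<alpha>::nat. \<exists>\<theta>\<^sub>\<alpha>. substitution {..<p ^ \<alpha>} \<theta>\<^sub>\<alpha> \<and> has_length {..<p ^ \<alpha>} p \<theta>\<^sub>\<alpha> \<and>
           fixed_point {..<p ^ \<alpha>} \<theta>\<^sub>\<alpha> (\<lambda>n. s n mod p ^ \<alpha>)"
proof
  fix \<alpha> :: nat
  interpret permutation_order p \<theta>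
  proof
    show "p \<ge> 2"
      using assms(1) by (rule prime_ge_2_nat)
    fix j assume j: "j < p"
    have sub: "set (\<theta> j) \<subseteq> {..<p}"
      using assms(2) j by (simp add: substitution_def)
    have count: "count_list (\<theta> j) i = 1" if "i < p" for i
      using assms(3) j that by (simp add: incidence_matrix_def)
    show set: "set (\<theta> j) = {..<p}"
      using sub count by (metis count_notin lessThan_iff subsetI subset_antisym zero_neq_one)
    \<comment> \<open>The counts add up to the length, which is therefore \<open>p\<close>, the
      number of letters that occur.\<close>
    show "distinct (\<theta> j)"
      using sum_count_set[OF sub] count by (intro card_distinct) (simp add: set)
  qed (fact assms(5))
  define u where "u = fixed_word p \<theta>"
  have s: "s = radix_value p u"
    unfolding u_def assms(8) by (rule cocycle_eq_radix_value[OF assms(6,7)])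
  have u_less: "u n < p" and u_0: "u 0 = 0" for n
    by (simp_all add: u_def fixed_word_less fixed_word_0)
  have s_mod: "s n mod p = u n" for n
    unfolding s using radix_value_mod p_ge_2 u_0 u_less by blast
  have s_block: "s (n * p + j) = \<theta> (u n) ! j + p * s n" if "j < p" for n j
  proof -
    have "(n * p + j) div p = n" "(n * p + j) mod p = j"
      using that by simp_all
    then show ?thesis
      unfolding s u_def using radix_value_rec[of p "fixed_word p \<theta>"] p_ge_2 fixed_word_0 fixed_word_rec
      by metis
  qed
  \<comment> \<open>Read off from \<open>s_block\<close>, with \<open>u n\<close> recovered as
    \<open>s n mod p\<close>.\<close>
  define \<theta>\<^sub>\<alpha> where "\<theta>\<^sub>\<alpha> a = map (\<lambda>j. (\<theta> (a mod p) ! j + p * a) mod p ^ \<alpha>) [0..<p]" for a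
  have pos: "p ^ \<alpha> > 0"
    using p_ge_2 by simp
  have "s (n * p + j) mod p ^ \<alpha> = \<theta>\<^sub>\<alpha> (s n mod p ^ \<alpha>) ! j" if "j < p" for n j
  \<comment> \<open>For \<alpha> > 0, \<open>p\<close> divides \<open>p ^ \<alpha>\<close>, so the
    residue of \<open>s n\<close> still determines \<open>u n\<close>. For \<alpha> = 0 that fails,
    but the alphabet is just {0}.\<close>
  proof (cases "\<alpha> = 0")
    case False
    then have "s n mod p ^ \<alpha> mod p = u n"
      by (simp add: mod_mod_cancel s_mod)
    then have "\<theta>\<^sub>\<alpha> (s n mod p ^ \<alpha>) ! j = (\<theta> (u n) ! j + p * (s n mod p ^ \<alpha>)) mod p ^ \<alpha>"
      using that by (simp add: \<theta>\<^sub>\<alpha>_def)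
    also have "\<dots> = (\<theta> (u n) ! j + p * s n) mod p ^ \<alpha>"
      by (intro mod_add_cong refl mod_mult_right_eq)
    finally show ?thesis
      by (simp add: s_block that)
  qed (use that in \<open>simp add: \<theta>\<^sub>\<alpha>_def\<close>)
  then have "subst_image \<theta>\<^sub>\<alpha> (\<lambda>n. s n mod p ^ \<alpha>) (\<lambda>n. s n mod p ^ \<alpha>)"
    using p_ge_2 by (intro subst_image_if_constant_length[of p]) (simp_all add: \<theta>\<^sub>\<alpha>_def)
  then show "\<exists>\<theta>\<^sub>\<alpha>. substitution {..<p ^ \<alpha>} \<theta>\<^sub>\<alpha> \<and> has_length {..<p ^ \<alpha>} p \<theta>\<^sub>\<alpha> \<and>
      fixed_point {..<p ^ \<alpha>} \<theta>\<^sub>\<alpha> (\<lambda>n. s n mod p ^ \<alpha>)"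
    using pos by (intro exI[of _ \<theta>\<^sub>\<alpha>])
      (auto simp: substitution_def has_length_def fixed_point_def \<theta>\<^sub>\<alpha>_def)
qed

end
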